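(* Let $T$ be the binary rooted tree, let $n\ge2$ and let $v=x_1\cdots x_{n-1}$ be a non-empty word of length $n-1$ with letters in $\{0,1\}$. Let $\mathfrak K(v)=\langle a_1,\dots,a_n\rangle\subset\mathrm{Aut}(T)$ be the group generated by $$a_1=(a_n,1)\sigma,\qquad a_{i+1}=\begin{cases}(a_i,1)&\text{if }x_i=0,\\(1,a_i)&\text{if }x_i=1,\end{cases}\quad 1\le i\le n-1.$$ Then the germinal groupoid $\mathcal G(\partial T,\mathfrak K(v),\Phi)$ associated to the action of $\mathfrak K(v)$ on $\partial T$ has Hausdorff topology.
   Context: The binary rooted tree $T$ has as vertices the finite words over $\{0,1\}$ (root = empty word), each word $u$ joined by edges to $u0,u1$. $\partial T$ is the set of infinite words over $\{0,1\}$ with the product topology; $\mathrm{Aut}(T)$ acts on it by homeomorphisms. $\sigma\in\mathrm{Aut}(T)$ changes the first letter $z_1\mapsto z_1+1\bmod 2$ and fixes all other letters. For $g_0,g_1\in\mathrm{Aut}(T)$, $(g_0,g_1)$ denotes the automorphism $(g_0,g_1)(zw)=z\,g_z(w)$ for a letter $z$; in products, maps are composed on the left (the rightmost factor is applied first), so $(g_0,g_1)\sigma$ first applies $\sigma$ and then $(g_0,g_1)$. $1$ is the identity. Germinal groupoid of an action of a group $\Gamma$ on a space $\mathfrak X$: for $g\in\Gamma$, $y\in\mathfrak X$, the germ $[g]_y$ is the class of $g$ under $g_1\sim_y g_2$ iff $g_1\cdot y=g_2\cdot y$ and $g_1,g_2$ agree on an open neighborhood of $y$. $\mathcal G(\mathfrak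 X,\Gamma,\Phi)=\{[g]_y\}$ with the sheaf topology, with basis the sets $\{[g]_y\mid y\in U\}$, $g\in\Gamma$, $U\subset\mathfrak X$ open. *)

theory Defs
  imports "HOL-Analysis.Analysis" "HOL-Algebra.Generated_Groups"
begin

text \<open>The letters $0$ and $1$ are \<^const>\<open>False\<close> and \<^const>\<open>True\<close>; a vertex is a finite word.\<close>

definition tree_adj :: "bool list \<Rightarrow> bool list \<Rightarrow> bool" where
  "tree_adj u w \<longleftrightarrow> (\<exists>z. w = u @ [z] \<or> u = w @ [z])"

definition tree_auts :: "(bool list \<Rightarrow> bool list) set" where
  "tree_auts = {f. bij f \<and> f [] = [] \<and> (\<forall>u w. tree_adj (f u) (f w) \<longleftrightarrow> tree_adj u w)}"

definition Aut_T :: "(bool list \<Rightarrow> bool list) monoid" where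
  "Aut_T = \<lparr>carrier = tree_auts, mult = (\<circ>), one = id\<rparr>"

fun tree_sigma :: "bool list \<Rightarrow> bool list" where
  "tree_sigma [] = []"
| "tree_sigma (z # w) = (\<not> z) # w"

fun tree_pair :: "(bool list \<Rightarrow> bool list) \<Rightarrow> (bool list \<Rightarrow> bool list) \<Rightarrow> bool list \<Rightarrow> bool list" where
  "tree_pair g0 g1 [] = []"
| "tree_pair g0 g1 (z # w) = z # (if z then g1 w else g0 w)"

text \<open>An infinite word $z_1 z_2 \ldots$ is the function sending \<open>k\<close> to $z_{k+1}$.\<close>

definition boundary_T :: "(nat \<Rightarrow> bool) topology" where
  "boundary_T = product_topology (\<lambda>_. discrete_topology UNIV) UNIV"

definition word_prefix :: "nat \<Rightarrow> (nat \<Rightarrow> bool) \<Rightarrow> bool list" where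
  "word_prefix k y = map y [0..<k]"

text \<open>For a tree automorphism \<open>g\<close>, the infinite word \<open>boundary_action g y\<close> is the one whose
  prefixes are the images under \<open>g\<close> of the prefixes of \<open>y\<close>; see \<open>word_prefix_boundary_action\<close>.\<close>

definition boundary_action :: "(bool list \<Rightarrow> bool list) \<Rightarrow> (nat \<Rightarrow> bool) \<Rightarrow> (nat \<Rightarrow> bool)" where
  "boundary_action g y = (\<lambda>k. g (word_prefix (Suc k) y) ! k)"

text \<open>\<open>\<Phi> g\<close> is the self-map of the space \<open>X\<close> by which \<open>g\<close> acts, and \<open>\<Gamma>\<close> is the underlying set of
  the acting group.\<close>

definition germ_rel :: "'x topology \<Rightarrow> 'g set \<Rightarrow> ('g \<Rightarrow> 'x \<Rightarrow> 'x) \<Rightarrow> 'x \<Rightarrow> ('g \<times> 'g) set" where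
  "germ_rel X \<Gamma> \<Phi> y =
     {(g1, g2). g1 \<in> \<Gamma> \<and> g2 \<in> \<Gamma> \<and> \<Phi> g1 y = \<Phi> g2 y \<and>
        (\<exists>U. openin X U \<and> y \<in> U \<and> (\<forall>z\<in>U. \<Phi> g1 z = \<Phi> g2 z))}"

text \<open>A germ carries its base point, since the classes of \<open>g\<close> at two different points can be equal
  as subsets of \<open>\<Gamma>\<close>.\<close>

definition germ :: "'x topology \<Rightarrow> 'g set \<Rightarrow> ('g \<Rightarrow> 'x \<Rightarrow> 'x) \<Rightarrow> 'g \<Rightarrow> 'x \<Rightarrow> 'g set \<times> 'x" where
  "germ X \<Gamma> \<Phi> g y = (germ_rel X \<Gamma> \<Phi> y `` {g}, y)"

definition germ_basis :: "'x topology \<Rightarrow> 'g set \<Rightarrow> ('g \<Rightarrow> 'x \<Rightarrow> 'x) \<Rightarrow> ('g set \<times> 'x) set set" where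
  "germ_basis X \<Gamma> \<Phi> = {germ X \<Gamma> \<Phi> g ` U | g U. g \<in> \<Gamma> \<and> openin X U}"

text \<open>The points of this topological space are the germs, and \<open>germ_basis\<close> is a basis of it, not
  merely a subbasis; see \<open>topspace_germinal_groupoid\<close> and \<open>openin_germinal_groupoid\<close>.\<close>

definition germinal_groupoid ::
    "'x topology \<Rightarrow> 'g set \<Rightarrow> ('g \<Rightarrow> 'x \<Rightarrow> 'x) \<Rightarrow> ('g set \<times> 'x) topology" where
  "germinal_groupoid X \<Gamma> \<Phi> = topology_generated_by (germ_basis X \<Gamma> \<Phi>)"

lemma topspace_germinal_groupoid:
  "topspace (germinal_groupoid X \<Gamma> \<Phi>) = {germ X \<Gamma> \<Phi> g y | g y. g \<in> \<Gamma> \<and> y \<in> topspace X}"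
  unfolding germinal_groupoid_def germ_basis_def
  by (auto dest: openin_subset)

lemma germ_eq_iff:
  assumes "g \<in> \<Gamma>" "h \<in> \<Gamma>"
  shows "germ X \<Gamma> \<Phi> g y = germ X \<Gamma> \<Phi> h y' \<longleftrightarrow>
    y = y' \<and> ((g, h) \<in> germ_rel X \<Gamma> \<Phi> y \<or> y \<notin> topspace X)"
proof (cases "y \<in> topspace X")
  case False
  then have "germ_rel X \<Gamma> \<Phi> y = {}"
    by (auto simp: germ_rel_def dest: openin_subset)
  then show ?thesis using False by (auto simp: germ_def)
next
  case True
  have "equiv \<Gamma> (germ_rel X \<Gamma> \<Phi> y)"
  proof (rule equivI)
    show "germ_rel X \<Gamma> \<Phi> y \<subseteq> \<Gamma> \<times> \<Gamma>"
      by (auto simp: germ_rel_def)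
    show "refl_on \<Gamma> (germ_rel X \<Gamma> \<Phi> y)"
      using True by (auto simp: refl_on_def germ_rel_def)
    show "sym (germ_rel X \<Gamma> \<Phi> y)"
      by (force simp: sym_def germ_rel_def)
    show "trans (germ_rel X \<Gamma> \<Phi> y)"
    proof (rule transI)
      fix g h k
      assume "(g, h) \<in> germ_rel X \<Gamma> \<Phi> y" "(h, k) \<in> germ_rel X \<Gamma> \<Phi> y"
      then obtain U V where "g \<in> \<Gamma>" "k \<in> \<Gamma>" "\<Phi> g y = \<Phi> k y"
        "openin X U" "y \<in> U" "\<forall>z\<in>U. \<Phi> g z = \<Phi> h z"
        "openin X V" "y \<in> V" "\<forall>z\<in>V. \<Phi> h z = \<Phi> k z"
        by (auto simp: germ_rel_def)
      then have "openin X (U \<inter> V)" "y \<in> U \<inter> V" "\<forall>z\<in>U \<inter> V. \<Phi> g z = \<Phi> k z"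
        by auto
      with \<open>g \<in> \<Gamma>\<close> \<open>k \<in> \<Gamma>\<close> \<open>\<Phi> g y = \<Phi> k y\<close> show "(g, k) \<in> germ_rel X \<Gamma> \<Phi> y"
        unfolding germ_rel_def by blast
    qed
  qed
  then have "germ_rel X \<Gamma> \<Phi> y `` {g} = germ_rel X \<Gamma> \<Phi> y `` {h} \<longleftrightarrow> (g, h) \<in> germ_rel X \<Gamma> \<Phi> y"
    using eq_equiv_class_iff assms by fast
  then show ?thesis
    using True unfolding germ_def prod.inject by blast
qed

lemma openin_germinal_groupoid:
  "openin (germinal_groupoid X \<Gamma> \<Phi>) = arbitrary union_of (\<lambda>S. S \<in> germ_basis X \<Gamma> \<Phi>)"
proof -
  let ?B = "germ_basis X \<Gamma> \<Phi>"
  have "S \<inter> T \<in> ?B" if ST: "S \<in> ?B" "T \<in> ?B" for S T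
  proof -
    obtain g U h V where S: "S = germ X \<Gamma> \<Phi> g ` U" "g \<in> \<Gamma>" "openin X U"
      and T: "T = germ X \<Gamma> \<Phi> h ` V" "h \<in> \<Gamma>" "openin X V"
      using ST unfolding germ_basis_def by auto
    define W where "W = {y \<in> U \<inter> V. (g, h) \<in> germ_rel X \<Gamma> \<Phi> y}"
    have "openin X W"
    proof (subst openin_subopen, intro ballI)
      fix y assume "y \<in> W"
      then obtain N where N: "openin X N" "y \<in> N" "\<forall>z\<in>N. \<Phi> g z = \<Phi> h z" and "y \<in> U" "y \<in> V"
        unfolding W_def germ_rel_def by auto
      have "openin X (N \<inter> U \<inter> V)" using N S T by auto
      moreover have "N \<inter> U \<inter> V \<subseteq> W"
        using N S T unfolding W_def germ_rel_def by auto
      ultimately show "\<exists>M. openin X M \<and> y \<in> M \<and> M \<subseteq> W"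
        using \<open>y \<in> N\<close> \<open>y \<in> U\<close> \<open>y \<in> V\<close> by blast
    qed
    moreover have "S \<inter> T = germ X \<Gamma> \<Phi> g ` W"
    proof -
      have "U \<subseteq> topspace X" using S openin_subset by blast
      then have eq: "germ X \<Gamma> \<Phi> g y = germ X \<Gamma> \<Phi> h y' \<longleftrightarrow> y = y' \<and> (g, h) \<in> germ_rel X \<Gamma> \<Phi> y"
        if "y \<in> U" for y y'
        using that germ_eq_iff[OF S(2) T(2), of X \<Phi> y y'] by blast
      show ?thesis
      proof (intro equalityI subsetI)
        fix c assume "c \<in> S \<inter> T"
        then obtain y y' where "y \<in> U" "y' \<in> V" "c = germ X \<Gamma> \<Phi> g y" "c = germ X \<Gamma> \<Phi> h y'"
          unfolding S T by blast
        then show "c \<in> germ X \<Gamma> \<Phi> g ` W"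
          using eq[of y y'] unfolding W_def by blast
      next
        fix c assume "c \<in> germ X \<Gamma> \<Phi> g ` W"
        then obtain y where "y \<in> U" "y \<in> V" "(g, h) \<in> germ_rel X \<Gamma> \<Phi> y" "c = germ X \<Gamma> \<Phi> g y"
          unfolding W_def by blast
        then show "c \<in> S \<inter> T"
          using eq[of y y] unfolding S T by blast
      qed
    qed
    ultimately show ?thesis
      using S unfolding germ_basis_def by auto
  qed
  then have "istopology (arbitrary union_of (\<lambda>S. S \<in> ?B))"
    by (intro istopology_base) auto
  then have eq: "openin (topology (arbitrary union_of (\<lambda>S. S \<in> ?B)))
      = arbitrary union_of (\<lambda>S. S \<in> ?B)"
    by (simp add: topology_inverse')
  have "openin (germinal_groupoid X \<Gamma> \<Phi>) S
      \<longleftrightarrow> openin (topology (arbitrary union_of (\<lambda>S. S \<in> ?B))) S" for S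
  proof
    assume "openin (germinal_groupoid X \<Gamma> \<Phi>) S"
    then have "generate_topology_on ?B S"
      by (simp add: germinal_groupoid_def openin_topology_generated_by_iff)
    then show "openin (topology (arbitrary union_of (\<lambda>S. S \<in> ?B))) S"
    proof induction
      case (Basis s)
      then show ?case by (simp add: eq arbitrary_union_of_inc)
    qed auto
  next
    assume "openin (topology (arbitrary union_of (\<lambda>S. S \<in> ?B))) S"
    then have "(arbitrary union_of (\<lambda>S. S \<in> ?B)) S"
      by (simp only: eq)
    then obtain \<U> where "\<U> \<subseteq> ?B" "S = \<Union>\<U>"
      unfolding union_of_def by auto
    then show "openin (germinal_groupoid X \<Gamma> \<Phi>) S"
      unfolding germinal_groupoid_def \<open>S = \<Union>\<U>\<close>
      by (intro openin_Union topology_generated_by_Basis) auto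
  qed
  then show ?thesis unfolding eq by auto
qed

lemma tree_aut_butlast:
  assumes "f \<in> tree_auts"
  shows "length (f u) = length u \<and> f (butlast u) = butlast (f u)"
proof (induction "length u" arbitrary: u rule: less_induct)
  case less
  show ?case
  proof (cases u rule: rev_cases)
    case Nil
    then show ?thesis using assms by (simp add: tree_auts_def)
  next
    case (snoc p x)
    have IH: "length (f p) = length p" "f (butlast p) = butlast (f p)"
      using less[of p] snoc by auto
    have inj: "f a = f b \<Longrightarrow> a = b" for a b
      using assms by (auto simp: tree_auts_def bij_def inj_def)
    have "tree_adj (f p) (f u)"
      using assms snoc unfolding tree_auts_def tree_adj_def by blast
    then obtain y where "f u = f p @ [y] \<or> f p = f u @ [y]"
      unfolding tree_adj_def by blast
    moreover have False if *: "f p = f u @ [y]"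
    proof -
      have "f u = f (butlast p)" using * IH by simp
      then have "u = butlast p" by (rule inj)
      then have "length u \<le> length p" by simp
      then show False using snoc by simp
    qed
    ultimately show ?thesis using snoc IH by auto
  qed
qed

lemma tree_autI:
  assumes inj: "inj f" and len: "\<And>u. length (f u) = length u"
    and bl: "\<And>u. f (butlast u) = butlast (f u)"
  shows "f \<in> tree_auts"
proof -
  have "w \<in> range f" for w
  proof -
    let ?L = "{u :: bool list. length u = length w}"
    have "finite ?L"
      using finite_lists_length_eq[of "UNIV :: bool set" "length w"] by simp
    moreover have "f ` ?L \<subseteq> ?L" using len by auto
    ultimately have "f ` ?L = ?L"
      by (rule endo_inj_surj) (rule inj_on_subset[OF inj subset_UNIV])
    then show ?thesis by blast
  qed
  then have "bij f" using inj by (auto simp: bij_def)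
  moreover have "f [] = []" using len[of "[]"] by simp
  moreover have child: "(\<exists>z. f w = f u @ [z]) \<longleftrightarrow> (\<exists>z. w = u @ [z])" for u w
  proof
    assume "\<exists>z. w = u @ [z]"
    then have "f u = butlast (f w)" "f w \<noteq> []"
      using bl[of w] len[of w] by auto
    then show "\<exists>z. f w = f u @ [z]" by (metis append_butlast_last_id)
  next
    assume "\<exists>z. f w = f u @ [z]"
    then have "f u = f (butlast w)" "w \<noteq> []"
      using bl[of w] len[of w] by auto
    then show "\<exists>z. w = u @ [z]"
      using inj by (metis append_butlast_last_id injD)
  qed
  ultimately show ?thesis
    unfolding tree_auts_def tree_adj_def by (simp add: ex_disj_distrib)
qed

lemma group_Aut_T: "group Aut_T"
proof (rule groupI)
  fix f assume f: "f \<in> carrier Aut_T"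
  then have "bij f" by (simp add: Aut_T_def tree_auts_def)
  let ?h = "inv_into UNIV f"
  have ff: "f (?h u) = u" for u
    using \<open>bij f\<close> by (simp add: bij_is_surj surj_f_inv_f)
  have "tree_adj (?h u) (?h w) \<longleftrightarrow> tree_adj u w" for u w
  proof -
    have "tree_adj (f (?h u)) (f (?h w)) \<longleftrightarrow> tree_adj (?h u) (?h w)"
      using f unfolding Aut_T_def tree_auts_def by simp
    then show ?thesis by (simp add: ff)
  qed
  moreover have "?h [] = []"
    using f \<open>bij f\<close> bij_inv_eq_iff[of f "[]" "[]"] by (simp add: Aut_T_def tree_auts_def)
  ultimately have "?h \<in> carrier Aut_T"
    using \<open>bij f\<close> by (simp add: Aut_T_def tree_auts_def bij_imp_bij_inv)
  moreover have "?h \<otimes>\<^bsub>Aut_T\<^esub> f = \<one>\<^bsub>Aut_T\<^esub>"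
    using \<open>bij f\<close> by (simp add: Aut_T_def bij_is_inj)
  ultimately show "\<exists>g\<in>carrier Aut_T. g \<otimes>\<^bsub>Aut_T\<^esub> f = \<one>\<^bsub>Aut_T\<^esub>" by blast
qed (auto simp: Aut_T_def tree_auts_def bij_comp comp_assoc)

lemma word_prefix_boundary_action:
  assumes "g \<in> tree_auts"
  shows "word_prefix k (boundary_action g y) = g (word_prefix k y)"
proof (induction k)
  case 0
  then show ?case using assms by (simp add: word_prefix_def tree_auts_def)
next
  case (Suc k)
  let ?w = "word_prefix (Suc k) y"
  have len: "length (g ?w) = Suc k" and bl: "g (butlast ?w) = butlast (g ?w)"
    using tree_aut_butlast[OF assms, of ?w] by (simp_all add: word_prefix_def)
  have ne: "g ?w \<noteq> []" using len by auto
  have "last (g ?w) = boundary_action g y k"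
    unfolding boundary_action_def last_conv_nth[OF ne] len by simp
  moreover have "butlast ?w = word_prefix k y" by (simp add: word_prefix_def)
  then have "butlast (g ?w) = word_prefix k (boundary_action g y)"
    using Suc bl by simp
  ultimately have "g ?w = word_prefix k (boundary_action g y) @ [boundary_action g y k]"
    using append_butlast_last_id[OF ne] by simp
  then show ?case by (simp add: word_prefix_def)
qed

fun kneading_gen :: "bool list \<Rightarrow> nat \<Rightarrow> bool list \<Rightarrow> bool list" where
  "kneading_gen v i [] = []"
| "kneading_gen v i (z # w) =
     (if i \<le> 1 then (\<not> z) # (if z then kneading_gen v (Suc (length v)) w else w)
      else z # (if z = v ! (i - 2) then kneading_gen v (i - 1) w else w))"

lemma kneading_gen_in_tree_auts: "kneading_gen v i \<in> tree_auts"
proof (rule tree_autI)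
  show len: "length (kneading_gen v i u) = length u" for u
    by (induction u arbitrary: i) auto
  have ne: "kneading_gen v i u \<noteq> []" if "u \<noteq> []" for i u
    using that by (cases u) auto
  show "kneading_gen v i (butlast u) = butlast (kneading_gen v i u)" for u
    by (induction u arbitrary: i) (auto simp: ne)
  have "kneading_gen v i u = kneading_gen v i u' \<Longrightarrow> u = u'" for u u'
  proof (induction u arbitrary: i u')
    case Nil
    then show ?case using ne[of u' i] by (cases "u' = []") auto
  next
    case (Cons z w)
    then show ?case by (cases u') (auto split: if_splits)
  qed
  then show "inj (kneading_gen v i)" by (rule injI)
qed

lemma kneading_generators_exist:
  assumes "n \<ge> 2" "length v = n - 1"
  shows "\<exists>a. (\<forall>i\<in>{1..n}. a i \<in> carrier Aut_T) \<and>
    a 1 = tree_pair (a n) id \<circ> tree_sigma \<and>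
    (\<forall>i\<in>{1..n - 1}. a (i + 1) = (if v ! (i - 1) = False then tree_pair (a i) id else tree_pair id (a i)))"
proof (intro exI[of _ "kneading_gen v"] conjI ballI)
  show "kneading_gen v i \<in> carrier Aut_T" for i
    by (simp add: Aut_T_def kneading_gen_in_tree_auts)
  show "kneading_gen v 1 = tree_pair (kneading_gen v n) id \<circ> tree_sigma"
  proof
    fix u show "kneading_gen v 1 u = (tree_pair (kneading_gen v n) id \<circ> tree_sigma) u"
      using assms by (cases u) auto
  qed
  fix i assume "i \<in> {1..n - 1}"
  then have "i \<ge> 1" by simp
  show "kneading_gen v (i + 1) = (if v ! (i - 1) = False then tree_pair (kneading_gen v i) id
      else tree_pair id (kneading_gen v i))"
  proof
    fix u show "kneading_gen v (i + 1) u = (if v ! (i - 1) = False then tree_pair (kneading_gen v i) id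
      else tree_pair id (kneading_gen v i)) u"
      using \<open>i \<ge> 1\<close> by (cases u) auto
  qed
qed

lemma kneading_generators_unique:
  assumes "n \<ge> 2" "length v = n - 1"
    and "a 1 = tree_pair (a n) id \<circ> tree_sigma"
    and "\<forall>i\<in>{1..n - 1}. a (i + 1) =
      (if v ! (i - 1) = False then tree_pair (a i) id else tree_pair id (a i))"
    and "i \<in> {1..n}"
  shows "a i = kneading_gen v i"
proof
  fix u show "a i u = kneading_gen v i u"
    using \<open>i \<in> {1..n}\<close>
  proof (induction u arbitrary: i)
    case Nil
    then show ?case
    proof (cases "i = 1")
      case False
      then have "i - 1 \<in> {1..n - 1}" using Nil by auto
      from assms(4)[rule_format, OF this] show ?thesis using False Nil by (simp split: if_splits)
    next
      case True
      have "a i [] = (tree_pair (a n) id \<circ> tree_sigma) []" unfolding True assms(3) ..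
      then show ?thesis by simp
    qed
  next
    case (Cons z w)
    show ?case
    proof (cases "i = 1")
      case True
      have "Suc (length v) = n" using assms(1,2) by simp
      have "a i (z # w) = (tree_pair (a n) id \<circ> tree_sigma) (z # w)" unfolding True assms(3) ..
      with True \<open>Suc (length v) = n\<close> show ?thesis using assms(1) Cons.IH[of n] by simp
    next
      case False
      then have "i - 1 \<in> {1..n - 1}" "i - 1 \<in> {1..n}" using Cons.prems by auto
      with False show ?thesis
        using assms(4)[rule_format, of "i - 1"] Cons.IH[of "i - 1"] Cons.prems
        by (auto simp: numeral_2_eq_2)
    qed
  qed
qed

end

theory Submission
  imports Defs
begin

text \<open>
  The group acts freely on germs: an element that fixes an infinite word \<open>y\<close> is trivial on a
  neighbourhood of \<open>y\<close> (\<open>word_act_trivial_near_fixed_point\<close>). Hence a germ is determined by its base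
  point and its image point, and the Hausdorff property passes from the boundary of the tree to the
  space of germs (\<open>Hausdorff_germinal_groupoid\<close>).

  For the freeness, put $n = |v| + 1$ and write the group element as a word in the generators and
  their inverses. Below each vertex on the ray \<open>y\<close> it acts by a section, which is a word with at most
  as many letters, since the section of a generator is a generator or the identity. If a letter is
  lost along \<open>y\<close>, induction on the length of the word applies to the shorter section. Otherwise
  every letter survives along the orbit of \<open>y\<close>. Now a generator survives along only one infinite word
  $p_i$, and its inverse only along the image $q_i$ of $p_i$. Both are periodic with period $n$, and
  they differ exactly in one position modulo $n$. So the word of length $m$ is a closed path with
  $m$ edges in the graph on the $p_i$ and $q_i$ in which the \<open>i\<close>-th generator joins $p_i$ to $q_i$.

  This graph has two properties. No $p_i$ equals a $q_j$ (\<open>orbit_word_sign\<close>), so the path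
  alternates between generators and inverses of generators. And either the $p_i$ are pairwise
  distinct or the $q_i$ are (\<open>orbit_word_faithful_sign\<close>): two periodic sequences that differ in a single
  position modulo $n$ cannot both have a period that is not a multiple of $n$. Each component of
  the graph is therefore a star, and a nonempty closed path in a star backtracks. Backtracking
  cancels a generator against its inverse, and again a shorter word is obtained.
\<close>

section \<open>Spaces of germs of free actions\<close>

text \<open>The assumption \<open>germs\<close> is the freeness: a germ is determined by its base point and its image.\<close>

lemma Hausdorff_germinal_groupoid:
  assumes haus: "Hausdorff_space X"
    and cont: "\<And>g. g \<in> \<Gamma> \<Longrightarrow> continuous_map X X (\<Phi> g)"
    and germs: "\<And>g h y. \<lbrakk>g \<in> \<Gamma>; h \<in> \<Gamma>; y \<in> topspace X; \<Phi> g y = \<Phi> h y\<rbrakk>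
      \<Longrightarrow> (g, h) \<in> germ_rel X \<Gamma> \<Phi> y"
  shows "Hausdorff_space (germinal_groupoid X \<Gamma> \<Phi>)"
proof -
  have basic: "openin (germinal_groupoid X \<Gamma> \<Phi>) (germ X \<Gamma> \<Phi> g ` U)"
    if "g \<in> \<Gamma>" "openin X U" for g U
    using that unfolding germinal_groupoid_def germ_basis_def
    by (intro topology_generated_by_Basis) blast
  have "\<exists>U V. openin (germinal_groupoid X \<Gamma> \<Phi>) U \<and> openin (germinal_groupoid X \<Gamma> \<Phi>) V
      \<and> germ X \<Gamma> \<Phi> g y \<in> U \<and> germ X \<Gamma> \<Phi> h y' \<in> V \<and> disjnt U V"
    if g: "g \<in> \<Gamma>" and h: "h \<in> \<Gamma>" and y: "y \<in> topspace X" and y': "y' \<in> topspace X"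
      and ne: "germ X \<Gamma> \<Phi> g y \<noteq> germ X \<Gamma> \<Phi> h y'" for g h y y'
  proof (cases "y = y'")
    case False
    then obtain U V where UV: "openin X U" "openin X V" "y \<in> U" "y' \<in> V" "disjnt U V"
      using haus y y' unfolding Hausdorff_space_def by metis
    have "disjnt (germ X \<Gamma> \<Phi> g ` U) (germ X \<Gamma> \<Phi> h ` V)"
      using UV(5) by (auto simp: disjnt_def germ_def)
    then show ?thesis using basic[OF g UV(1)] basic[OF h UV(2)] UV(3,4) by blast
  next
    case True
    then have "\<Phi> g y \<noteq> \<Phi> h y"
      using ne germs[OF g h y] germ_eq_iff[OF g h, of X \<Phi> y y'] by blast
    moreover have "\<Phi> g y \<in> topspace X" "\<Phi> h y \<in> topspace X"
      using cont g h y by (meson continuous_map_image_subset_topspace image_subset_iff)+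
    ultimately obtain A B where AB: "openin X A" "openin X B" "\<Phi> g y \<in> A" "\<Phi> h y \<in> B" "disjnt A B"
      using haus unfolding Hausdorff_space_def by metis
    let ?W = "{z \<in> topspace X. \<Phi> g z \<in> A} \<inter> {z \<in> topspace X. \<Phi> h z \<in> B}"
    have W: "openin X ?W"
      using openin_continuous_map_preimage[OF cont[OF g] AB(1)]
        openin_continuous_map_preimage[OF cont[OF h] AB(2)] by blast
    have "disjnt (germ X \<Gamma> \<Phi> g ` ?W) (germ X \<Gamma> \<Phi> h ` ?W)"
    proof -
      have False if "z \<in> ?W" "z' \<in> ?W" and eq: "germ X \<Gamma> \<Phi> g z = germ X \<Gamma> \<Phi> h z'" for z z'
      proof -
        have "z = z'" "(g, h) \<in> germ_rel X \<Gamma> \<Phi> z"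
          using eq that(1) unfolding germ_eq_iff[OF g h] by auto
        then have "\<Phi> g z = \<Phi> h z" by (simp add: germ_rel_def)
        then show False using that(1) AB(5) by (auto simp: disjnt_def)
      qed
      then show ?thesis unfolding disjnt_def by blast
    qed
    moreover have "y \<in> ?W" using y AB by simp
    ultimately show ?thesis using basic[OF g W] basic[OF h W] True by blast
  qed
  then show ?thesis
    unfolding Hausdorff_space_def topspace_germinal_groupoid by blast
qed

section \<open>The action on the boundary of the tree\<close>

lemma length_word_prefix [simp]: "length (word_prefix k y) = k"
  by (simp add: word_prefix_def)

lemma word_prefix_nth [simp]: "j < k \<Longrightarrow> word_prefix k y ! j = y j"
  by (simp add: word_prefix_def)

lemma word_prefix_0 [simp]: "word_prefix 0 y = []"
  by (simp add: word_prefix_def)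

lemma word_prefix_eq_iff: "word_prefix k y = word_prefix k z \<longleftrightarrow> (\<forall>j<k. y j = z j)"
  by (auto simp: list_eq_iff_nth_eq)

lemma infinite_word_eqI: "(\<And>k. word_prefix k y = word_prefix k z) \<Longrightarrow> y = z"
  by (auto simp: word_prefix_eq_iff fun_eq_iff)

lemma word_prefix_add: "word_prefix (k + m) y = word_prefix k y @ word_prefix m (\<lambda>j. y (k + j))"
  by (auto simp: list_eq_iff_nth_eq nth_append)

lemma word_prefix_Suc: "word_prefix (Suc k) y = y 0 # word_prefix k (\<lambda>j. y (Suc j))"
  using word_prefix_add[of 1 k y] by (simp add: word_prefix_def)

lemma topspace_boundary_T [simp]: "topspace boundary_T = UNIV"
  by (simp add: boundary_T_def)

lemma openin_cylinder: "openin boundary_T {z. word_prefix k z = word_prefix k y}"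
proof -
  have "openin boundary_T (\<Pi>\<^sub>E j\<in>UNIV. if j < k then {y j} else UNIV)"
    unfolding boundary_T_def by (rule product_topology_basis) auto
  moreover have "(\<Pi>\<^sub>E j\<in>UNIV. if j < k then {y j} else UNIV) = {z. word_prefix k z = word_prefix k y}"
    by (simp add: word_prefix_eq_iff PiE_UNIV_domain Pi_def set_eq_iff)
  ultimately show ?thesis by simp
qed

lemma Hausdorff_boundary_T: "Hausdorff_space boundary_T"
  by (simp add: boundary_T_def Hausdorff_space_product_topology)

lemma continuous_boundary_action: "continuous_map boundary_T boundary_T (boundary_action g)"
proof -
  have "continuous_map boundary_T (discrete_topology UNIV) (\<lambda>y. boundary_action g y k)" for k
    unfolding continuous_map_def
  proof (intro conjI allI impI)
    fix U :: "bool set"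
    show "openin boundary_T {y \<in> topspace boundary_T. boundary_action g y k \<in> U}"
    proof (subst openin_subopen, intro ballI exI conjI)
      fix y assume y: "y \<in> {y \<in> topspace boundary_T. boundary_action g y k \<in> U}"
      let ?C = "{z. word_prefix (Suc k) z = word_prefix (Suc k) y}"
      show "openin boundary_T ?C" by (rule openin_cylinder)
      show "y \<in> ?C" by simp
      show "?C \<subseteq> {y \<in> topspace boundary_T. boundary_action g y k \<in> U}"
        using y by (auto simp: boundary_action_def)
    qed
  qed simp
  then show ?thesis
    unfolding boundary_T_def by (simp add: continuous_map_componentwise_UNIV)
qed

text \<open>Agreement of two automorphisms on the vertices below a prefix of \<open>y\<close> gives equal germs at \<open>y\<close>.\<close>

lemma germ_rel_boundary_actionI:
  assumes "\<Gamma> \<subseteq> tree_auts" "g \<in> \<Gamma>" "h \<in> \<Gamma>"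
    and agree: "\<And>u. g (word_prefix k y @ u) = h (word_prefix k y @ u)"
  shows "(g, h) \<in> germ_rel boundary_T \<Gamma> boundary_action y"
proof -
  let ?C = "{z. word_prefix k z = word_prefix k y}"
  have eq: "boundary_action g z = boundary_action h z" if "z \<in> ?C" for z
  proof
    fix j
    have "word_prefix (k + Suc j) z = word_prefix k y @ word_prefix (Suc j) (\<lambda>i. z (k + i))"
      using that by (simp only: word_prefix_add mem_Collect_eq)
    then have "g (word_prefix (k + Suc j) z) = h (word_prefix (k + Suc j) z)"
      using agree by simp
    then have "word_prefix (k + Suc j) (boundary_action g z) = word_prefix (k + Suc j) (boundary_action h z)"
      using assms(1-3) by (simp add: word_prefix_boundary_action subset_iff)
    then show "boundary_action g z j = boundary_action h z j"
      by (simp add: word_prefix_eq_iff)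
  qed
  have "openin boundary_T ?C" "y \<in> ?C" by (simp_all add: openin_cylinder)
  with eq show ?thesis using assms(2,3) unfolding germ_rel_def by blast
qed

section \<open>Generators as states of a cyclic automaton\<close>

text \<open>With $n = |v| + 1$, \<open>knead v e\<close> is the $n$-periodic sequence on the integers with period
  $e\, x_1 \cdots x_{n-1}$, whose entry \<open>e\<close> is at the multiples of $n$.\<close>

definition knead :: "bool list \<Rightarrow> bool \<Rightarrow> int \<Rightarrow> bool" where
  "knead v e c = (e # v) ! nat (c mod int (Suc (length v)))"

text \<open>The period $n$.\<close>

abbreviation klen :: "bool list \<Rightarrow> int" where
  "klen v \<equiv> int (Suc (length v))"

lemma knead_0: "klen v dvd c \<Longrightarrow> knead v e c = e"
  by (simp add: knead_def dvd_eq_mod_eq_0 del: of_nat_Suc)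

lemma knead_indep:
  assumes "\<not> klen v dvd c" shows "knead v e c = knead v e' c"
proof -
  have "c mod klen v \<noteq> 0" using assms by (simp only: dvd_eq_mod_eq_0 not_False_eq_True)
  moreover have "c mod klen v \<ge> 0" by simp
  ultimately have "nat (c mod klen v) > 0" by linarith
  then show ?thesis by (simp add: knead_def nth_Cons' del: of_nat_Suc)
qed

lemma knead_cong: "klen v dvd c - c' \<Longrightarrow> knead v e c = knead v e c'"
  by (simp add: knead_def mod_eq_dvd_iff[symmetric] del: of_nat_Suc)

text \<open>The state \<open>(c, e)\<close> stands for the generator $a_{c+1}$ if \<open>e\<close> holds and for its inverse otherwise,
  where \<open>c\<close> is read modulo $n$. With this indexing all states obey one rule: the section of
  \<open>(c, e)\<close> is \<open>(c - 1, e)\<close> at the letter \<open>knead v e c\<close> and the identity at the other letter, and the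
  letter is flipped just for \<open>c\<close> divisible by $n$.\<close>

fun state_act :: "bool list \<Rightarrow> int \<times> bool \<Rightarrow> bool list \<Rightarrow> bool list" where
  "state_act v (c, e) [] = []"
| "state_act v (c, e) (z # u) =
     (if klen v dvd c then \<not> z else z) # (if z = knead v e c then state_act v (c - 1, e) u else u)"

lemma state_act_cong: "klen v dvd c - c' \<Longrightarrow> state_act v (c, e) u = state_act v (c', e) u"
proof (induction u arbitrary: c c')
  case (Cons z u)
  have "klen v dvd c \<longleftrightarrow> klen v dvd c'"
    using dvd_add_right_iff[OF Cons.prems, of c'] by (simp del: of_nat_Suc)
  moreover have "state_act v (c - 1, e) u = state_act v (c' - 1, e) u"
    using Cons.prems by (intro Cons.IH) simp
  ultimately show ?case using knead_cong[OF Cons.prems, of e] by simp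
qed simp

lemma state_act_cancel: "state_act v (c, e) (state_act v (c, \<not> e) u) = u"
proof (induction u arbitrary: c)
  case (Cons z u)
  show ?case
    using Cons knead_0[of v c] knead_indep[of v c e "\<not> e"] by (cases "klen v dvd c") auto
qed simp

lemma kneading_gen_eq_state_act:
  "1 \<le> i \<Longrightarrow> i \<le> Suc (length v) \<Longrightarrow> kneading_gen v i u = state_act v (int i - 1, True) u"
proof (induction u arbitrary: i)
  case (Cons z u)
  show ?case
  proof (cases "i = 1")
    case True
    have "- 1 - (klen v - 1) = - klen v" by simp
    then have "state_act v (-1, True) u = state_act v (klen v - 1, True) u"
      by (intro state_act_cong) (simp only: dvd_minus_iff dvd_refl)
    then show ?thesis using True Cons.IH[of "Suc (length v)"] by (simp add: knead_0)
  next
    case False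
    then have i: "i \<ge> 2" using Cons.prems by simp
    have m: "(int i - 1) mod klen v = int i - 1"
      using Cons.prems by (intro mod_pos_pos_trivial) auto
    have "\<not> klen v dvd int i - 1"
      unfolding dvd_eq_mod_eq_0 m using i by simp
    moreover have "knead v True (int i - 1) = v ! (i - 2)"
      unfolding knead_def m using i by (simp add: nth_Cons' nat_diff_distrib numeral_2_eq_2)
    moreover have "kneading_gen v (i - 1) u = state_act v (int i - 1 - 1, True) u"
      using i Cons.prems Cons.IH[of "i - 1"] by (simp add: of_nat_diff)
    ultimately show ?thesis using i by auto
  qed
qed simp

text \<open>The only infinite word along which the sections of the state never become trivial: $p_{c+1}$ for
  \<open>(c, True)\<close> and $q_{c+1}$ for \<open>(c, False)\<close>. See \<open>state_section_nonempty\<close>.\<close>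

definition orbit_word :: "bool list \<Rightarrow> int \<times> bool \<Rightarrow> nat \<Rightarrow> bool" where
  "orbit_word v s k = knead v (snd s) (fst s - int k)"

lemma word_prefix_Suc_orbit_word:
  "word_prefix (Suc k) (orbit_word v (c, e)) = knead v e c # word_prefix k (orbit_word v (c - 1, e))"
proof -
  have "(\<lambda>j. orbit_word v (c, e) (Suc j)) = orbit_word v (c - 1, e)"
    by (simp add: orbit_word_def fun_eq_iff algebra_simps)
  then show ?thesis by (simp add: word_prefix_Suc) (simp add: orbit_word_def)
qed

lemma state_act_orbit_word:
  "state_act v (c, e) (word_prefix k (orbit_word v (c, e))) = word_prefix k (orbit_word v (c, \<not> e))"
proof (induction k arbitrary: c)
  case (Suc k)
  then show ?case
    using knead_0[of v c] knead_indep[of v c e "\<not> e"]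
    by (cases "klen v dvd c") (simp_all add: word_prefix_Suc_orbit_word)
qed simp

lemma orbit_word_eqD:
  assumes "orbit_word v (c, e) = orbit_word v (c', e')"
  shows "knead v e k = knead v e' (k + (c' - c))"
proof -
  \<comment> \<open>a positive representative of the position modulo the period\<close>
  define j where "j = nat ((c - k) mod klen v)"
  have "int j = (c - k) mod klen v" by (simp add: j_def del: of_nat_Suc)
  then have "(c - int j) - k = (c - k) - (c - k) mod klen v" by simp
  then have j: "klen v dvd (c - int j) - k" by (simp only: dvd_minus_mod)
  have "knead v e (c - int j) = knead v e' (c' - int j)"
    using fun_cong[OF assms, of j] by (simp add: orbit_word_def)
  moreover have "knead v e (c - int j) = knead v e k" by (rule knead_cong[OF j])
  moreover have "knead v e' (c' - int j) = knead v e' (k + (c' - c))"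
    using j by (intro knead_cong) (simp add: algebra_simps)
  ultimately show ?thesis by simp
qed

text \<open>No $p_i$ equals a $q_j$. Otherwise \<open>knead v (\<not> e)\<close> would be \<open>knead v e\<close> shifted by some \<open>d\<close>. Since
  the two sequences agree off the multiples of $n$, the value \<open>e\<close> of \<open>knead v e\<close> at 0 would
  propagate to \<open>knead v (\<not> e)\<close> at every positive multiple of \<open>d\<close>, hence at $n d$, where
  the value is \<open>\<not> e\<close>.\<close>

lemma orbit_word_sign:
  assumes "orbit_word v (c, e) = orbit_word v (c', e')"
  shows "e = e'"
proof (rule ccontr)
  assume "e \<noteq> e'"
  then have e': "e' = (\<not> e)" by auto
  define d where "d = c' - c"
  have shift: "knead v e k = knead v (\<not> e) (k + d)" for k
    using orbit_word_eqD[OF assms] e' by (simp add: d_def)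
  have "knead v (\<not> e) (int (Suc m) * d) = e" for m
  proof (induction m)
    case 0
    then show ?case using shift[of 0] knead_0[of v 0 e] by simp
  next
    case (Suc m)
    then have "\<not> klen v dvd int (Suc m) * d" using knead_0 by metis
    then have "knead v e (int (Suc m) * d) = e" using Suc knead_indep by metis
    then show ?case using shift[of "int (Suc m) * d"] by (simp add: algebra_simps)
  qed
  from this[of "length v"] show False using knead_0[of v "klen v * d" "\<not> e"] by simp
qed

text \<open>If both shifts were nontrivial modulo $n$, then passing from 0 to \<open>d + d'\<close> via \<open>d\<close> and via \<open>d'\<close>
  would give different values of the two sequences at \<open>d + d'\<close>, so $n$ divides \<open>d + d'\<close>. Then
  \<open>- d\<close> and \<open>d'\<close> are the same position modulo $n$, where the sequences agree, although their values
  there are those at 0.\<close>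

lemma knead_period:
  assumes "\<And>k. knead v False k = knead v False (k + d)" "\<And>k. knead v True k = knead v True (k + d')"
  shows "klen v dvd d \<or> klen v dvd d'"
proof (rule ccontr)
  assume "\<not> ?thesis"
  then have d: "\<not> klen v dvd d" and d': "\<not> klen v dvd d'" by blast+
  have "\<not> knead v False d" using assms(1)[of 0] knead_0[of v 0 False] by simp
  then have "\<not> knead v True (d + d')" using assms(2)[of d] knead_indep[OF d, of True False] by simp
  moreover have "knead v True d'" using assms(2)[of 0] knead_0[of v 0 True] by simp
  then have "knead v False (d + d')"
    using assms(1)[of d'] knead_indep[OF d', of True False] by (simp add: add.commute)
  ultimately have dd: "klen v dvd d' - (- d)" using knead_indep by (metis add.commute diff_minus_eq_add)
  have "\<not> knead v False (- d)" using assms(1)[of "- d"] knead_0[of v 0 False] by simp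
  moreover have "knead v True (- d)" using \<open>knead v True d'\<close> knead_cong[OF dd] by simp
  moreover have "\<not> klen v dvd - d" using d by (simp only: dvd_minus_iff not_False_eq_True)
  ultimately show False using knead_indep by blast
qed

text \<open>The $p_i$ or the $q_i$ are pairwise distinct.\<close>

lemma orbit_word_faithful_sign:
  obtains e where "\<And>c c'. orbit_word v (c, e) = orbit_word v (c', e) \<Longrightarrow> klen v dvd c - c'"
proof (cases "\<exists>c c'. orbit_word v (c, False) = orbit_word v (c', False) \<and> \<not> klen v dvd c - c'")
  case False
  then show thesis using that[of False] by blast
next
  case True
  then obtain c0 c0' where eq0: "orbit_word v (c0, False) = orbit_word v (c0', False)"
    and ndvd: "\<not> klen v dvd c0 - c0'" by blast
  show thesis
  proof (rule that[of True])
    fix c c' assume eq: "orbit_word v (c, True) = orbit_word v (c', True)"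
    have "klen v dvd c0' - c0 \<or> klen v dvd c' - c"
      by (rule knead_period[OF orbit_word_eqD[OF eq0] orbit_word_eqD[OF eq]])
    then show "klen v dvd c - c'"
      using ndvd by (simp only: dvd_diff_commute[of _ c0'] dvd_diff_commute[of _ c'] simp_thms)
  qed
qed

section \<open>Words in the generators and their sections\<close>

text \<open>Words are lists of states. The last letter acts first.\<close>

fun word_act :: "bool list \<Rightarrow> (int \<times> bool) list \<Rightarrow> bool list \<Rightarrow> bool list" where
  "word_act v [] = id"
| "word_act v (s # ws) = state_act v s \<circ> word_act v ws"

lemma word_act_append: "word_act v (ws @ ws') = word_act v ws \<circ> word_act v ws'"
  by (induction ws) auto

lemma length_state_act [simp]: "length (state_act v s u) = length u"
  by (induction v s u rule: state_act.induct) auto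

lemma length_word_act [simp]: "length (word_act v ws u) = length u"
  by (induction ws) auto

text \<open>The section of a state at a vertex, as a word: it is one state, or the empty word if the section
  is trivial because \<open>u\<close> has left the orbit word.\<close>

fun state_section :: "bool list \<Rightarrow> int \<times> bool \<Rightarrow> bool list \<Rightarrow> (int \<times> bool) list" where
  "state_section v (c, e) [] = [(c, e)]"
| "state_section v (c, e) (z # u) = (if z = knead v e c then state_section v (c - 1, e) u else [])"

text \<open>The section of a word at \<open>u\<close>, letter by letter and without cancellation. Each letter is read at
  the image of \<open>u\<close> under the letters to its right.\<close>

fun word_section :: "bool list \<Rightarrow> (int \<times> bool) list \<Rightarrow> bool list \<Rightarrow> (int \<times> bool) list" where
  "word_section v [] u = []"
| "word_section v (s # ws) u = state_section v s (word_act v ws u) @ word_section v ws u"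

lemma state_act_append: "state_act v s (u @ w) = state_act v s u @ word_act v (state_section v s u) w"
  by (induction v s u rule: state_section.induct) auto

lemma word_act_append_word:
  "word_act v ws (u @ w) = word_act v ws u @ word_act v (word_section v ws u) w"
  by (induction ws arbitrary: w) (auto simp: state_act_append word_act_append)

lemma length_state_section: "length (state_section v s u) \<le> 1"
  by (induction v s u rule: state_section.induct) auto

lemma length_word_section: "length (word_section v ws u) \<le> length ws"
proof (induction ws)
  case (Cons s ws)
  then show ?case using length_state_section[of v s "word_act v ws u"] by simp
qed simp

lemma state_section_nonempty:
  "state_section v (c, e) u \<noteq> [] \<Longrightarrow> u = word_prefix (length u) (orbit_word v (c, e))"
proof (induction u arbitrary: c)
  case (Cons z u)
  then have "z = knead v e c" "state_section v (c - 1, e) u \<noteq> []" by (auto split: if_splits)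
  with Cons.IH[of "c - 1"] show ?case by (simp add: word_prefix_Suc_orbit_word)
qed simp

text \<open>All letters of the word survive along \<open>y\<close>, which the word maps to \<open>y'\<close>: every letter is applied
  to its own orbit word.\<close>

fun surviving :: "bool list \<Rightarrow> (int \<times> bool) list \<Rightarrow> (nat \<Rightarrow> bool) \<Rightarrow> (nat \<Rightarrow> bool) \<Rightarrow> bool" where
  "surviving v [] y y' \<longleftrightarrow> y' = y"
| "surviving v ((c, e) # ws) y y' \<longleftrightarrow>
     surviving v ws y (orbit_word v (c, e)) \<and> y' = orbit_word v (c, \<not> e)"

lemma surviving_word_act:
  "surviving v ws y y' \<Longrightarrow> word_act v ws (word_prefix k y) = word_prefix k y'"
  by (induction v ws y y' rule: surviving.induct) (auto simp: state_act_orbit_word)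

lemma surviving_if_section_full:
  "(\<And>k. length (word_section v ws (word_prefix k y)) = length ws) \<Longrightarrow> \<exists>y'. surviving v ws y y'"
proof (induction ws)
  case (Cons s ws)
  obtain c e where s: "s = (c, e)" by fastforce
  have len: "length (word_section v ws (word_prefix k y)) = length ws
      \<and> state_section v s (word_act v ws (word_prefix k y)) \<noteq> []" for k
    using Cons.prems[of k] length_state_section[of v s "word_act v ws (word_prefix k y)"]
      length_word_section[of v ws "word_prefix k y"] by auto
  with Cons.IH obtain y' where y': "surviving v ws y y'" by blast
  have "word_prefix k y' = word_prefix k (orbit_word v (c, e))" for k
    using len[of k] state_section_nonempty[of v c e "word_prefix k y'"]
    by (simp add: s surviving_word_act[OF y'])
  then have "y' = orbit_word v (c, e)" by (rule infinite_word_eqI)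
  then show ?case using y' s by auto
qed auto

lemma word_act_cancel:
  assumes "klen v dvd c - c'"
  shows "word_act v (ws @ (c, e) # (c', \<not> e) # ws') = word_act v (ws @ ws')"
proof -
  have "state_act v (c, e) \<circ> state_act v (c', \<not> e) = id"
    using state_act_cong[OF assms] state_act_cancel[of v c' e] by (auto simp: fun_eq_iff)
  then show ?thesis by (simp add: word_act_append fun_eq_iff)
qed

text \<open>A closed path in the graph of the orbit words backtracks within its last three edges.\<close>

lemma surviving_loop_shortens:
  assumes "surviving v ws y y" "ws \<noteq> []"
  obtains ws' where "length ws' < length ws" "word_act v ws' = word_act v ws"
proof -
  obtain e0 where faithful:
    "\<And>c c'. orbit_word v (c, e0) = orbit_word v (c', e0) \<Longrightarrow> klen v dvd c - c'"
    using orbit_word_faithful_sign by blast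
  obtain c e ws1 where ws1: "ws = (c, e) # ws1" using assms(2) by (metis list.exhaust surj_pair)
  have y: "y = orbit_word v (c, \<not> e)" and surv1: "surviving v ws1 y (orbit_word v (c, e))"
    using assms(1) ws1 by auto
  \<comment> \<open>a path of length one joins different orbit words, so it is not closed\<close>
  have "ws1 \<noteq> []" using surv1 y orbit_word_sign[of v c e c "\<not> e"] by auto
  then obtain c' e' ws2 where ws2: "ws1 = (c', e') # ws2" by (metis list.exhaust surj_pair)
  have eq1: "orbit_word v (c, e) = orbit_word v (c', \<not> e')"
    and surv2: "surviving v ws2 y (orbit_word v (c', e'))" using surv1 ws2 by auto
  have e': "e' = (\<not> e)" using orbit_word_sign[OF eq1] by simp
  show thesis
  proof (cases "e = e0 \<or> ws2 = []")
    case True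
    \<comment> \<open>the first two letters cancel; for a word of length two, both endpoints of the two edges agree\<close>
    have "klen v dvd c - c'"
    proof (cases "e = e0")
      case False
      then have "e0 = (\<not> e)" by auto
      moreover have "y = orbit_word v (c', \<not> e)" using True False surv2 e' by simp
      ultimately show ?thesis using faithful[of c c'] y by simp
    qed (use faithful eq1 e' in auto)
    from word_act_cancel[OF this, of "[]" e ws2] show thesis
      using that[of ws2] ws1 ws2 e' by simp
  next
    case False
    \<comment> \<open>the signs alternate, so the second and third letters meet at an orbit word of sign \<open>e0\<close> and cancel\<close>
    then obtain c'' e'' ws3 where ws3: "ws2 = (c'', e'') # ws3" by (metis list.exhaust surj_pair)
    then have eq2: "orbit_word v (c', e') = orbit_word v (c'', \<not> e'')" using surv2 by simp
    have e'': "e'' = (\<not> e')" using orbit_word_sign[OF eq2] by simp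
    have "e' = e0" using False e' by auto
    then have "klen v dvd c' - c''" using faithful eq2 e'' by auto
    from word_act_cancel[OF this, of "[(c, e)]" e' ws3] show thesis
      using that[of "(c, e) # ws3"] ws1 ws2 ws3 e'' by simp
  qed
qed

text \<open>Freeness on germs, by induction on the length of the word.\<close>

lemma word_act_trivial_near_fixed_point:
  assumes "\<And>k. word_act v ws (word_prefix k y) = word_prefix k y"
  shows "\<exists>k. \<forall>u. word_act v ws (word_prefix k y @ u) = word_prefix k y @ u"
  using assms
proof (induction "length ws" arbitrary: ws y rule: less_induct)
  case less
  show ?case
  proof (cases "\<exists>k. length (word_section v ws (word_prefix k y)) < length ws")
    case True
    then obtain k where k: "length (word_section v ws (word_prefix k y)) < length ws" by blast
    let ?ws = "word_section v ws (word_prefix k y)" and ?y = "\<lambda>j. y (k + j)"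
    have sect: "word_act v ws (word_prefix k y @ u) = word_prefix k y @ word_act v ?ws u" for u
      by (simp add: word_act_append_word less.prems)
    have "word_act v ?ws (word_prefix j ?y) = word_prefix j ?y" for j
      using less.prems[of "k + j"] sect[of "word_prefix j ?y"] by (simp add: word_prefix_add)
    from less.hyps[OF k this] obtain m where
      "\<And>u. word_act v ?ws (word_prefix m ?y @ u) = word_prefix m ?y @ u" by blast
    then have "word_act v ws (word_prefix (k + m) y @ u) = word_prefix (k + m) y @ u" for u
      using sect[of "word_prefix m ?y @ u"] by (simp add: word_prefix_add)
    then show ?thesis by blast
  next
    case False
    then have "length (word_section v ws (word_prefix k y)) = length ws" for k
      using length_word_section[of v ws "word_prefix k y"] by (metis le_neq_implies_less)
    then obtain y' where y': "surviving v ws y y'" using surviving_if_section_full by blast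
    have "y' = y"
      by (rule infinite_word_eqI) (metis surviving_word_act[OF y'] less.prems)
    show ?thesis
    proof (cases "ws = []")
      case False
      then obtain ws' where "length ws' < length ws" and eq: "word_act v ws' = word_act v ws"
        using surviving_loop_shortens y' \<open>y' = y\<close> by blast
      from less.hyps[OF this(1), of y] show ?thesis using less.prems unfolding eq by blast
    qed simp
  qed
qed

section \<open>The kneading group acts freely on germs\<close>

lemma generate_imp_word_act:
  assumes gens: "\<And>i. i \<in> I \<Longrightarrow> a i \<in> carrier Aut_T"
    and act: "\<And>i. i \<in> I \<Longrightarrow> a i = state_act v (int i - 1, True)"
    and g: "g \<in> generate Aut_T (a ` I)"
  shows "\<exists>ws. g = word_act v ws"
  using g
proof induction
  case one
  have "\<one>\<^bsub>Aut_T\<^esub> = word_act v []" by (simp add: Aut_T_def)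
  then show ?case ..
next
  case (incl h)
  then obtain i where "h = word_act v [(int i - 1, True)]" using act by auto
  then show ?case ..
next
  case (inv h)
  then obtain i where i: "i \<in> I" "h = a i" by blast
  have "inv\<^bsub>Aut_T\<^esub> h \<circ> h = id"
    using group.l_inv[OF group_Aut_T gens[OF i(1)]] i(2) by (simp add: Aut_T_def)
  moreover have "h \<circ> state_act v (int i - 1, False) = id"
    using state_act_cancel[of v "int i - 1" True] act[OF i(1)] i(2) by (auto simp: fun_eq_iff)
  ultimately have "inv\<^bsub>Aut_T\<^esub> h = state_act v (int i - 1, False)"
    by (metis comp_assoc comp_id id_comp)
  then have "inv\<^bsub>Aut_T\<^esub> h = word_act v [(int i - 1, False)]" by simp
  then show ?case ..
next
  case (eng h1 h2)
  then obtain ws1 ws2 where "h1 = word_act v ws1" "h2 = word_act v ws2" by blast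
  then have "h1 \<otimes>\<^bsub>Aut_T\<^esub> h2 = word_act v (ws1 @ ws2)" by (simp add: Aut_T_def word_act_append)
  then show ?case ..
qed

theorem theorem5p1:
  fixes n :: nat and v :: "bool list" and a :: "nat \<Rightarrow> bool list \<Rightarrow> bool list"
  assumes "n \<ge> 2" and "length v = n - 1"
    and "\<forall>i\<in>{1..n}. a i \<in> carrier Aut_T"
    and "a 1 = tree_pair (a n) id \<circ> tree_sigma"
    and "\<forall>i\<in>{1..n - 1}. a (i + 1) =
           (if v ! (i - 1) = False then tree_pair (a i) id else tree_pair id (a i))"
  shows "Hausdorff_space
           (germinal_groupoid boundary_T (generate Aut_T (a ` {1..n})) boundary_action)"
proof -
  let ?\<Gamma> = "generate Aut_T (a ` {1..n})"
  interpret group Aut_T by (rule group_Aut_T)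
  have gens: "a ` {1..n} \<subseteq> carrier Aut_T" using assms(3) by blast
  have auts: "?\<Gamma> \<subseteq> tree_auts"
    using generate_incl[OF gens] by (simp add: Aut_T_def)
  have act: "a i = state_act v (int i - 1, True)" if "i \<in> {1..n}" for i
    using kneading_generators_unique[OF assms(1,2,4,5) that] kneading_gen_eq_state_act[of i v] that assms(1,2)
    by auto
  have words: "\<exists>ws. g = word_act v ws" if "g \<in> ?\<Gamma>" for g
    by (rule generate_imp_word_act[OF _ act that]) (use assms(3) in blast)+
  show ?thesis
  proof (rule Hausdorff_germinal_groupoid[OF Hausdorff_boundary_T continuous_boundary_action])
    fix g h y
    assume g: "g \<in> ?\<Gamma>" and h: "h \<in> ?\<Gamma>" and eq: "boundary_action g y = boundary_action h y"
    have hg: "inv\<^bsub>Aut_T\<^esub> h \<otimes>\<^bsub>Aut_T\<^esub> g \<in> ?\<Gamma>"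
      using g generate_m_inv_closed[OF gens h] by (rule generate.eng[rotated])
    then obtain ws where ws: "inv\<^bsub>Aut_T\<^esub> h \<circ> g = word_act v ws"
      using words by (force simp: Aut_T_def)
    have hc: "h \<in> carrier Aut_T" using generate_incl[OF gens] h by blast
    have inv: "(inv\<^bsub>Aut_T\<^esub> h) (h u) = u" "h ((inv\<^bsub>Aut_T\<^esub> h) u) = u" for u
      using l_inv[OF hc] r_inv[OF hc] by (simp_all add: Aut_T_def fun_eq_iff)
    have "g (word_prefix k y) = h (word_prefix k y)" for k
      using eq g h auts by (metis word_prefix_boundary_action subsetD)
    then have "word_act v ws (word_prefix k y) = word_prefix k y" for k
      by (simp add: ws[symmetric] inv)
    then obtain k where "\<And>u. word_act v ws (word_prefix k y @ u) = word_prefix k y @ u"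
      using word_act_trivial_near_fixed_point by blast
    then have "g (word_prefix k y @ u) = h (word_prefix k y @ u)" for u
      using inv(2)[of "g (word_prefix k y @ u)"] by (simp add: ws[symmetric])
    then show "(g, h) \<in> germ_rel boundary_T ?\<Gamma> boundary_action y"
      by (rule germ_rel_boundary_actionI[OF auts g h])
  qed
qed

end
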